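(* Let $n\ge1$, $\beta>0$ and $f\in C^\beta_c(\mathbb{R}^n)$ (compactly supported and $\beta$-Hölder continuous). Let $e^{t\Delta}$ be the Gauss–Weierstrass semigroup $(e^{t\Delta}f)(x)=(4\pi t)^{-n/2}\int_{\mathbb{R}^n}e^{-|x-y|^2/(4t)}f(y)\,dy$. Then for every $x\in\mathbb{R}^n$ the integral \[ \log(-\Delta)f(x):=\int_0^\infty\frac{e^{-t}f(x)-(e^{t\Delta}f)(x)}{t}\,dt \] converges and \[ \log(-\Delta)f(x)=c_n\int_{B_1(x)}\frac{f(x)-f(y)}{|x-y|^n}\,dy-c_n\int_{\mathbb{R}^n\setminus B_1(x)}\frac{f(y)}{|x-y|^n}\,dy+\rho_n f(x), \] where $c_n=\pi^{-n/2}\Gamma(n/2)=2/|S^{n-1}|$ and $\rho_n=2\log2+\psi(n/2)-\gamma$.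
   Context: $\gamma=-\Gamma'(1)$ is the Euler–Mascheroni constant, $\psi=\Gamma'/\Gamma$ is the digamma function, $B_1(x)$ is the Euclidean unit ball centered at $x$, $|S^{n-1}|$ is the surface area of the unit sphere. The displayed time integral is the pointwise form of the Bochner formula $\log(-\Delta)f=\int_0^\infty t^{-1}(e^{-t}f-e^{t\Delta}f)\,dt$ for the spectrally defined logarithmic Laplacian of the Laplacian on $L^2(\mathbb{R}^n)$. *)

theory Defs
  imports "HOL-Analysis.Analysis"
begin

definition heat_semigroup :: "real \<Rightarrow> ('a::euclidean_space \<Rightarrow> real) \<Rightarrow> 'a \<Rightarrow> real" where
  "heat_semigroup t f x =
     (4 * pi * t) powr (- real DIM('a) / 2) *
     (LINT y|lborel. exp (- (norm (x - y))\<^sup>2 / (4 * t)) * f y)"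

definition c_const :: "nat \<Rightarrow> real" where
  "c_const n = pi powr (- real n / 2) * Gamma (real n / 2)"

definition rho_const :: "nat \<Rightarrow> real" where
  "rho_const n = 2 * ln 2 + Digamma (real n / 2) - euler_mascheroni"

end

theory Submission
  imports Defs
begin

text \<open>
  Let \<open>n\<close> be the dimension and write the semigroup as convolution with the heat kernel \<open>k\<close>. Then
  \<open>exp (-t) f(x) - heat_semigroup t f x\<close> is the integral of \<open>k t (x - y) (f x - f y)\<close> over
  \<open>ball x 1\<close>, minus the integral of \<open>k t (x - y) f y\<close> over the complement, plus
  \<open>f x (exp (-t) - P t)\<close>, where \<open>P t\<close> is the heat mass of \<open>ball x 1\<close>.
  In the first two terms Fubini applies and \<open>k t z / t\<close> integrates over \<open>t > 0\<close> to
  \<open>c_const n / norm z ^ n\<close>.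

  For the third term, \<open>norm z ^ 2 / (4 t)\<close> under \<open>k t z dz\<close> is a Gamma variable \<open>S\<close> of shape
  \<open>n / 2\<close>, so that \<open>P t\<close> is the probability of \<open>t < 1 / (4 S)\<close>, while \<open>exp (-t)\<close> is the
  probability of \<open>t < T\<close> for an exponential variable \<open>T\<close>. The layer-cake representation
  \<open>ln u = \<integral> (1[t < u] - 1[t < 1]) / t dt\<close> turns the time integral of \<open>(exp (-t) - P t) / t\<close> into
  \<open>E[ln T] - E[ln (1 / (4 S))]\<close>. As the expectation of the logarithm of a Gamma variable of shape
  \<open>a\<close> is \<open>Digamma a\<close>, by differentiating the Gamma integral, this is \<open>rho_const n\<close>.
\<close>

section \<open>Gamma distributions and the expectation of the logarithm\<close>

text \<open>A function on the whole line rather than a measure: expectations become integrals of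
  products over \<open>lborel\<close>, to which Fubini and dominated convergence apply
  directly.\<close>

definition gamma_density :: "real \<Rightarrow> real \<Rightarrow> real" where
  "gamma_density a s = indicator {0<..} s * (s powr (a - 1) * exp (- s)) / Gamma a"

lemma borel_measurable_gamma_density [measurable]: "gamma_density a \<in> borel_measurable borel"
  unfolding gamma_density_def by measurable

lemma gamma_density_nonneg: "a > 0 \<Longrightarrow> gamma_density a s \<ge> 0"
  by (auto simp: gamma_density_def indicator_def Gamma_real_pos less_imp_le)

lemma gamma_density_support: "gamma_density a s \<noteq> 0 \<Longrightarrow> s > 0"
  by (auto simp: gamma_density_def indicator_def split: if_splits)

lemma has_bochner_integral_gamma_density:
  assumes "a > 0"
  shows "has_bochner_integral lborel (gamma_density a) 1"
proof -
  have "((\<lambda>t. t powr (a - 1) / exp t / Gamma a) has_integral 1) {0..}"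
    using has_integral_divide[OF Gamma_integral_real[OF assms], of "Gamma a"]
      Gamma_real_pos[OF assms] by simp
  moreover have "(if t \<in> {0..} then t powr (a - 1) / exp t / Gamma a else 0) = gamma_density a t" for t
    by (auto simp: gamma_density_def indicator_def exp_minus field_simps)
  ultimately have "(gamma_density a has_integral 1) UNIV"
    by (subst (asm) has_integral_restrict_UNIV[symmetric]) simp
  then have "integral\<^sup>N lborel (gamma_density a) = ennreal 1"
    using gamma_density_nonneg[OF assms] by (intro nn_integral_has_integral_lborel) auto
  then show ?thesis
    using gamma_density_nonneg assms by (intro has_bochner_integral_nn_integral) auto
qed

text \<open>The factor \<open>s powr h\<close> only shifts the shape from \<open>a\<close> to
  \<open>a + h\<close>; the ratio of the normalizing constants remains.\<close>

lemma has_bochner_integral_gamma_density_powr: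
  assumes "a > 0" "a + h > 0"
  shows "has_bochner_integral lborel (\<lambda>s. gamma_density a s * s powr h) (Gamma (a + h) / Gamma a)"
proof -
  have "has_bochner_integral lborel (\<lambda>s. Gamma (a + h) / Gamma a * gamma_density (a + h) s) (Gamma (a + h) / Gamma a * 1)"
    using has_bochner_integral_gamma_density[OF assms(2)] by (rule has_bochner_integral_mult_right)
  moreover have "Gamma (a + h) / Gamma a * gamma_density (a + h) s = gamma_density a s * s powr h" for s
    using Gamma_real_pos[OF assms(1)] Gamma_real_pos[OF assms(2)]
    by (auto simp: gamma_density_def indicator_def powr_add[symmetric] field_simps algebra_simps)
  ultimately show ?thesis by simp
qed

text \<open>Supplies a majorant, uniform in \<open>h\<close>, for differentiating the Gamma moments
  at \<open>h = 0\<close>. With \<open>u = \<bar>ln s\<bar>\<close> the quotient is at most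
  \<open>u * exp (d * u)\<close>; a second factor \<open>exp (d * u)\<close> absorbs
  \<open>d * u\<close>, and \<open>exp (2 * d * u)\<close> is one of the two powers of
  \<open>s\<close>.\<close>

lemma powr_diff_quotient_bound:
  fixes s d h :: real
  assumes "s > 0" "d > 0" "h \<noteq> 0" "\<bar>h\<bar> \<le> d"
  shows "\<bar>(s powr h - 1) / h\<bar> \<le> (s powr (2 * d) + s powr (- (2 * d))) / d"
proof -
  have *: "\<bar>exp v - 1\<bar> \<le> \<bar>v\<bar> * exp \<bar>v\<bar>" for v :: real
  proof (cases "v \<ge> 0")
    case True
    have "1 - v \<le> exp (- v)" using exp_ge_add_one_self[of "- v"] by simp
    then have "exp v * (1 - v) \<le> exp v * exp (-v)" by (intro mult_left_mono) auto
    then show ?thesis using True by (simp add: exp_minus algebra_simps)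
  next
    case False
    then have "1 - exp v \<le> - v" using exp_ge_add_one_self[of v] by linarith
    also have "\<dots> \<le> - v * exp (- v)" using False by (simp add: mult_le_cancel_left1)
    finally show ?thesis using False by simp
  qed
  let ?u = "\<bar>ln s\<bar>"
  have "\<bar>(s powr h - 1) / h\<bar> = \<bar>exp (h * ln s) - 1\<bar> / \<bar>h\<bar>"
    using assms by (simp add: powr_def abs_divide)
  also have "\<dots> \<le> (\<bar>h * ln s\<bar> * exp \<bar>h * ln s\<bar>) / \<bar>h\<bar>"
    by (intro divide_right_mono *) auto
  also have "\<dots> = ?u * exp (\<bar>h\<bar> * ?u)" using assms by (simp add: abs_mult)
  also have "\<dots> \<le> ?u * exp (d * ?u)" using assms by (intro mult_left_mono) (auto intro: mult_right_mono)
  also have "\<dots> = (d * ?u) * exp (d * ?u) / d" using assms by simp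
  also have "\<dots> \<le> exp (d * ?u) * exp (d * ?u) / d"
    using assms exp_ge_add_one_self[of "d * ?u"]
    by (intro divide_right_mono mult_right_mono) (linarith, auto)
  also have "exp (d * ?u) * exp (d * ?u) = exp (2 * d * ?u)" by (simp add: exp_add[symmetric])
  also have "exp (2 * d * ?u) \<le> s powr (2 * d) + s powr (- (2 * d))"
    using assms by (cases "ln s \<ge> 0") (auto simp: powr_def abs_if add_increasing add_increasing2)
  finally show ?thesis using assms by (simp add: divide_right_mono)
qed

text \<open>Both sides are the derivative at \<open>h = 0\<close> of the moment
  \<open>Gamma (a + h) / Gamma a\<close>: dominated convergence differentiates under the integral,
  and the derivative of \<open>Gamma\<close> gives \<open>Digamma\<close>.\<close>

lemma has_bochner_integral_gamma_density_ln:
  assumes "a > 0"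
  shows "has_bochner_integral lborel (\<lambda>s. gamma_density a s * ln s) (Digamma a)"
proof -
  \<comment> \<open>A third of \<open>a\<close> keeps the shape \<open>a - 2 * d\<close> positive,
    so that both powers in the majorant have finite expectation.\<close>
  define d where "d = a / 3"
  have d: "d > 0" "a - 2 * d > 0" "a + 2 * d > 0" using assms by (auto simp: d_def)
  define h where "h i = d / real (Suc i)" for i :: nat
  have h: "h i > 0" "h i \<le> d" for i
    using d by (auto simp: h_def divide_simps algebra_simps)
  have h_lim: "h \<longlonglongrightarrow> 0" unfolding h_def
    by (rule LIMSEQ_Suc, rule lim_const_over_n)
  have "h i \<noteq> 0" for i using h(1)[of i] by simp
  with h_lim have h_at: "filterlim h (at 0) sequentially" by (simp add: filterlim_at)
  let ?s = "\<lambda>i s. gamma_density a s * ((s powr h i - 1) / h i)"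
  let ?w = "\<lambda>s. gamma_density a s * ((s powr (2 * d) + s powr (- (2 * d))) / d)"
  have int_s: "has_bochner_integral lborel (?s i) ((Gamma (a + h i) / Gamma a - 1) / h i)" for i
  proof -
    have "has_bochner_integral lborel (\<lambda>s. (gamma_density a s * s powr h i - gamma_density a s) / h i)
      ((Gamma (a + h i) / Gamma a - 1) / h i)"
      using h[of i] assms
      by (intro has_bochner_integral_divide_zero has_bochner_integral_diff 
         has_bochner_integral_gamma_density has_bochner_integral_gamma_density_powr) auto
    then show ?thesis by (simp add: field_simps)
  qed
  have int_w: "integrable lborel ?w"
  proof -
    have "has_bochner_integral lborel (\<lambda>s. (gamma_density a s * s powr (2*d) + gamma_density a s * s powr (-(2*d))) / d)
      ((Gamma (a + 2*d) / Gamma a + Gamma (a + - (2*d)) / Gamma a) / d)"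
      using d assms
      by (intro has_bochner_integral_divide_zero has_bochner_integral_add has_bochner_integral_gamma_density_powr) auto
    then show ?thesis by (simp add: has_bochner_integral_iff field_simps)
  qed
  have lim: "AE s in lborel. (\<lambda>i. ?s i s) \<longlonglongrightarrow> gamma_density a s * ln s"
  proof (rule AE_I2)
    fix s :: real
    show "(\<lambda>i. ?s i s) \<longlonglongrightarrow> gamma_density a s * ln s"
    proof (cases "s > 0")
      case True
      have "((\<lambda>h. s powr h) has_field_derivative ln s) (at 0)"
        using True by (auto intro!: derivative_eq_intros)
      then have "((\<lambda>h. (s powr h - 1) / h) \<longlongrightarrow> ln s) (at 0)"
        using True by (simp add: DERIV_def)
      moreover have "filterlim h (at 0) sequentially"
        by (rule h_at)
      ultimately have "(\<lambda>i. (s powr h i - 1) / h i) \<longlonglongrightarrow> ln s"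
        by (rule filterlim_compose)
      then show ?thesis by (intro tendsto_intros)
    qed (simp add: gamma_density_def)
  qed
  have bnd: "AE s in lborel. norm (?s i s) \<le> ?w s" for i
  proof (rule AE_I2)
    fix s :: real
    show "norm (?s i s) \<le> ?w s"
    proof (cases "s > 0")
      case True
      then show ?thesis
        using powr_diff_quotient_bound[OF True d(1), of "h i"] h[of i] gamma_density_nonneg[OF assms, of s]
        by (simp add: abs_mult mult_left_mono del: times_divide_eq_right)
    qed (simp add: gamma_density_def)
  qed
  have meas: "?s i \<in> borel_measurable lborel" "(\<lambda>s. gamma_density a s * ln s) \<in> borel_measurable lborel" for i
    by measurable
  have "(\<lambda>i. integral\<^sup>L lborel (?s i)) \<longlonglongrightarrow> integral\<^sup>L lborel (\<lambda>s. gamma_density a s * ln s)"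
    by (rule integral_dominated_convergence[where w = ?w]) (fact meas int_w lim bnd)+
  moreover have "(\<lambda>i. integral\<^sup>L lborel (?s i)) \<longlonglongrightarrow> Digamma a"
  proof -
    have "a \<notin> \<int>\<^sub>\<le>\<^sub>0" using assms by auto
    from has_field_derivative_Gamma[OF this, of UNIV]
    have "((\<lambda>h. (Gamma (a + h) - Gamma a) / h) \<longlongrightarrow> Gamma a * Digamma a) (at 0)"
      by (simp add: DERIV_def)
    moreover have "filterlim h (at 0) sequentially"
      by (rule h_at)
    ultimately have "(\<lambda>i. (Gamma (a + h i) - Gamma a) / h i) \<longlonglongrightarrow> Gamma a * Digamma a"
      by (rule filterlim_compose)
    then have "(\<lambda>i. (Gamma (a + h i) - Gamma a) / h i / Gamma a) \<longlonglongrightarrow> Gamma a * Digamma a / Gamma a"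
      using Gamma_real_pos[OF assms] by (intro tendsto_divide tendsto_const) auto
    moreover have "(Gamma (a + h i) - Gamma a) / h i / Gamma a = integral\<^sup>L lborel (?s i)" for i
      using int_s[of i] Gamma_real_pos[OF assms] h(1)[of i]
      by (simp add: has_bochner_integral_iff divide_simps) 
    ultimately show ?thesis using Gamma_real_pos[OF assms] by simp
  qed
  ultimately have "integral\<^sup>L lborel (\<lambda>s. gamma_density a s * ln s) = Digamma a"
    by (rule LIMSEQ_unique)
  moreover have "integrable lborel (\<lambda>s. gamma_density a s * ln s)"
    by (rule integrable_dominated_convergence[where w = ?w]) (fact meas int_w lim bnd)+
  ultimately show ?thesis by (simp add: has_bochner_integral_iff)
qed

section \<open>Integration of radial functions\<close>

lemma has_bochner_integral_powr_from_0:
  fixes a u :: real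
  assumes a: "a > 0" and u: "u \<ge> 0"
  shows "has_bochner_integral lborel (\<lambda>s. indicator {0<..<u} s * s powr (a - 1)) (u powr a / a)"
proof -
  have "((\<lambda>s. s powr (a - 1)) has_integral (u powr a / a)) {0<..<u}"
    using has_integral_powr_from_0[of "a - 1" u] a u by (simp add: has_integral_Icc_iff_Ioo)
  then have "((\<lambda>s. indicator {0<..<u} s * s powr (a - 1)) has_integral (u powr a / a)) UNIV"
    by (subst (asm) has_integral_restrict_UNIV[symmetric], elim has_integral_eq[rotated])
       (simp add: indicator_def)
  then have "integral\<^sup>N lborel (\<lambda>s. indicator {0<..<u} s * s powr (a - 1)) = ennreal (u powr a / a)"
    by (intro nn_integral_has_integral_lborel) auto
  then show ?thesis using a by (intro has_bochner_integral_nn_integral) auto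
qed

text \<open>It suffices to compare the two measures on the half-lines \<open>{..<u}\<close>, which
  generate the Borel sets and are stable under intersection. There one side is the volume of a ball
  of radius \<open>sqrt (c * u)\<close>, the other the integral of a power over
  \<open>{0<..<u}\<close>.\<close>

lemma distr_sq_dist_eq_density:
  fixes x :: "'a::euclidean_space"
  assumes c: "c > 0"
  defines "a \<equiv> real DIM('a) / 2"
  shows "distr lborel borel (\<lambda>y. (norm (x - y))\<^sup>2 / c) =
    density lborel (\<lambda>s. ennreal (indicator {0<..} s * ((pi * c) powr a / Gamma a * s powr (a - 1))))"
    (is "?M = ?N")
proof (rule measure_eqI_generator_eq)
  have a: "a > 0" by (simp add: a_def)
  let ?A = "(pi * c) powr a / Gamma a"
  have A: "?A > 0" using c Gamma_real_pos[OF a] by simp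
  show "Int_stable (range (lessThan :: real \<Rightarrow> real set))"
  proof (rule Int_stableI_image)
    show "\<exists>k\<in>UNIV. {..<i} \<inter> {..<j} = {..<k}" for i j :: real
      by (intro bexI[of _ "min i j"]) auto
  qed
  show "sets ?M = sigma_sets UNIV (range lessThan)" "sets ?N = sigma_sets UNIV (range lessThan)"
    by (simp_all add: borel_Iio)
  show "range (\<lambda>i::nat. {..<real i}) \<subseteq> range lessThan" by auto
  show "(\<Union>i::nat. {..<real i}) = UNIV" using reals_Archimedean2 by auto
  have M: "emeasure ?M {..<u} = (if u > 0 then ennreal (unit_ball_vol (DIM('a)) * sqrt (c * u) ^ DIM('a)) else 0)" for u
  proof -
    have "emeasure ?M {..<u} = emeasure lborel ((\<lambda>y. (norm (x - y))\<^sup>2 / c) -` {..<u})"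
      by (subst emeasure_distr) auto
    also have "(\<lambda>y. (norm (x - y))\<^sup>2 / c) -` {..<u} = (if u > 0 then ball x (sqrt (c * u)) else {})"
    proof -
      have "(norm (x - y))\<^sup>2 / c < u \<longleftrightarrow> norm (x - y) < sqrt (c * u)" for y
        using c real_less_rsqrt real_sqrt_less_mono[of "(norm (x - y))\<^sup>2" "c * u"]
        by (auto simp: field_simps) (metis abs_norm_cancel real_sqrt_abs real_sqrt_less_iff)
      moreover have "\<not> (norm (x - y))\<^sup>2 / c < u" if "\<not> u > 0" for y
        using c that by (meson divide_nonneg_pos not_less order_trans zero_le_power2)
      ultimately show ?thesis by (auto simp: dist_norm)
    qed
    finally show ?thesis using c by (auto simp: emeasure_ball)
  qed
  show "emeasure ?M {..<real i} \<noteq> \<infinity>" for i :: nat by (simp add: M)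
  fix X :: "real set" assume "X \<in> range lessThan"
  then obtain u where X: "X = {..<u}" by auto
  have N: "emeasure ?N X = (\<integral>\<^sup>+s. ennreal (indicator {0<..<u} s * (?A * s powr (a - 1))) \<partial>lborel)"
    unfolding X using A by (subst emeasure_density) (auto intro!: nn_integral_cong simp: indicator_def)
  show "emeasure ?M X = emeasure ?N X"
  proof (cases "u > 0")
    case False
    then have "{0<..<u} = {}" by auto
    then have "emeasure ?N X = 0" unfolding N by simp
    then show ?thesis using False by (simp add: X M)
  next
    case True
    have "has_bochner_integral lborel (\<lambda>s. ?A * (indicator {0<..<u} s * s powr (a - 1))) (?A * (u powr a / a))"
      using has_bochner_integral_powr_from_0[OF a, of u] True
      by (intro has_bochner_integral_mult_right) auto
    then have "emeasure ?N X = ennreal (?A * (u powr a / a))"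
      unfolding N using A a
      by (subst nn_integral_eq_integral) (auto simp: has_bochner_integral_iff mult_ac)
    \<comment> \<open>The factor \<open>1 / a\<close> from integrating the power turns
      \<open>Gamma a\<close> into the \<open>Gamma (a + 1)\<close> of the unit ball volume.\<close>
    also have "?A * (u powr a / a) = unit_ball_vol (DIM('a)) * sqrt (c * u) ^ DIM('a)"
    proof -
      have "sqrt (c * u) ^ DIM('a) = (c * u) powr a"
        using c True by (simp add: a_def powr_half_sqrt[symmetric] powr_realpow[symmetric] powr_powr)
      moreover have "Gamma (a + 1) = a * Gamma a" using a by (intro Gamma_plus1) auto
      moreover have "unit_ball_vol (DIM('a)) = pi powr a / Gamma (a + 1)"
        by (simp add: unit_ball_vol_def a_def)
      ultimately show ?thesis using c True a by (simp add: powr_mult field_simps)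
    qed
    finally show ?thesis using True by (simp add: X M)
  qed
qed auto

text \<open>Replaces polar coordinates: with the scaled squared distance as variable, the
  pushforward of Lebesgue measure has an explicit density and no surface measure enters.\<close>

lemma has_bochner_integral_radial_iff:
  fixes x :: "'a::euclidean_space" and g :: "real \<Rightarrow> real"
  assumes c: "c > 0" and [measurable]: "g \<in> borel_measurable borel"
  defines "a \<equiv> real DIM('a) / 2"
  shows "has_bochner_integral lborel (\<lambda>y. g ((norm (x - y))\<^sup>2 / c)) I \<longleftrightarrow>
    has_bochner_integral lborel (\<lambda>s. indicator {0<..} s * ((pi * c) powr a / Gamma a * s powr (a - 1)) * g s) I"
proof -
  let ?M = "distr lborel borel (\<lambda>y. (norm (x - y))\<^sup>2 / c)"
  let ?w = "\<lambda>s. indicator {0<..} s * ((pi * c) powr a / Gamma a * s powr (a - 1))"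
  have M: "?M = density lborel (\<lambda>s. ennreal (?w s))"
    using distr_sq_dist_eq_density[OF c, of x] by (simp add: a_def)
  have w: "?w s \<ge> 0" for s
    using Gamma_real_pos[of a] by (auto simp: indicator_def a_def)
  have "has_bochner_integral lborel (\<lambda>y. g ((norm (x - y))\<^sup>2 / c)) I \<longleftrightarrow> has_bochner_integral ?M g I"
    by (simp add: has_bochner_integral_iff integrable_distr_eq integral_distr)
  also have "\<dots> \<longleftrightarrow> has_bochner_integral lborel (\<lambda>s. ?w s * g s) I"
    unfolding M has_bochner_integral_iff using w
    by (subst integrable_real_density integral_real_density; simp)+
  finally show ?thesis .
qed

section \<open>The heat kernel, its mass and its integral over time\<close>

text \<open>The prefactor of the semigroup is part of the kernel, so that splitting the semigroup
  means splitting a single integral.\<close>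

definition heat_kernel :: "real \<Rightarrow> 'a::euclidean_space \<Rightarrow> real" where
  "heat_kernel t z = (4 * pi * t) powr (- real DIM('a) / 2) * exp (- (norm z)\<^sup>2 / (4 * t))"

lemma borel_measurable_heat_kernel [measurable (raw)]:
  assumes [measurable]: "p \<in> borel_measurable M" "q \<in> borel_measurable M"
  shows "(\<lambda>w. heat_kernel (p w) (q w)) \<in> borel_measurable M"
  unfolding heat_kernel_def by measurable

lemma heat_kernel_nonneg: "heat_kernel t z \<ge> 0"
  by (simp add: heat_kernel_def)

text \<open>For \<open>c = 4 * t\<close> the prefactor of the kernel cancels the power of
  \<open>pi * c\<close> in the radial density. What remains is a Gamma density that no longer
  depends on \<open>t\<close>.\<close>

lemma has_bochner_integral_heat_kernel_radial_iff:
  fixes x :: "'a::euclidean_space" and g :: "real \<Rightarrow> real"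
  assumes t: "t > 0" and [measurable]: "g \<in> borel_measurable borel"
  shows "has_bochner_integral lborel (\<lambda>y. heat_kernel t (x - y) * g ((norm (x - y))\<^sup>2 / (4 * t))) I \<longleftrightarrow>
    has_bochner_integral lborel (\<lambda>s. gamma_density (real DIM('a) / 2) s * g s) I"
proof -
  let ?a = "real DIM('a) / 2"
  let ?h = "\<lambda>s. (4 * pi * t) powr (- ?a) * exp (- s) * g s"
  have "heat_kernel t (x - y) * g ((norm (x - y))\<^sup>2 / (4 * t)) = ?h ((norm (x - y))\<^sup>2 / (4 * t))" for y
    by (simp add: heat_kernel_def)
  moreover have "indicator {0<..} s * ((pi * (4 * t)) powr ?a / Gamma ?a * s powr (?a - 1)) * ?h s
      = gamma_density ?a s * g s" for s
    using t by (simp add: gamma_density_def powr_minus field_simps)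
  ultimately show ?thesis
    using has_bochner_integral_radial_iff[of "4 * t" ?h x I] t by (simp only: mult_pos_pos) simp
qed

lemma has_bochner_integral_heat_kernel:
  fixes x :: "'a::euclidean_space"
  assumes "t > 0"
  shows "has_bochner_integral lborel (\<lambda>y. heat_kernel t (x - y)) 1"
  using has_bochner_integral_heat_kernel_radial_iff[OF assms, of "\<lambda>_. 1" x 1]
    has_bochner_integral_gamma_density[of "real DIM('a) / 2"] by simp

text \<open>The substitution \<open>t = (norm z)\<^sup>2 / (4 * s)\<close> turns the integrand into
  the claimed value times the Gamma density of shape \<open>n / 2\<close>, which has mass
  one.\<close>

lemma has_bochner_integral_heat_kernel_time:
  fixes z :: "'a::euclidean_space"
  assumes z: "z \<noteq> 0"
  shows "has_bochner_integral lborel (\<lambda>t. indicator {0<..} t * (heat_kernel t z / t))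
    (c_const DIM('a) / norm z ^ DIM('a))"
proof -
  let ?a = "real DIM('a) / 2"
  define r where "r = norm z"
  define C where "C = c_const DIM('a) / r ^ DIM('a)"
  have r: "r > 0" using z by (simp add: r_def)
  have a: "?a > 0" by simp
  have C: "C \<ge> 0" using r Gamma_real_pos[OF a] by (simp add: C_def c_const_def)
  define g where "g s = r\<^sup>2 / (4 * s)" for s :: real
  define g' where "g' s = - (r\<^sup>2 / (4 * s\<^sup>2))" for s :: real
  let ?f = "\<lambda>t. heat_kernel t z / t"
  have der: "(g has_field_derivative g' s) (at s within {0<..})" if "s \<in> {0<..}" for s
    using that unfolding g_def g'_def
    by (auto intro!: derivative_eq_intros simp: field_simps power2_eq_square)
  have inj: "inj_on g {0<..}" using r by (auto simp: inj_on_def g_def field_simps)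
  have img: "g ` {0<..} = {0<..}"
  \<comment> \<open>On the positive half-line \<open>g\<close> is its own inverse, which provides
    the preimage of \<open>t\<close>.\<close>
  proof safe
    fix t :: real assume "t > 0"
    then show "t \<in> g ` {0<..}" using r by (intro image_eqI[of _ _ "r\<^sup>2 / (4 * t)"]) (auto simp: g_def)
  qed (use r in \<open>auto simp: g_def\<close>)
  have eq: "\<bar>g' s\<bar> * ?f (g s) = C * gamma_density ?a s" if s: "s > 0" for s
  proof -
    have 1: "(norm z)\<^sup>2 / (4 * g s) = s" using s r by (simp add: g_def r_def field_simps)
    \<comment> \<open>The measure \<open>dt / t\<close> becomes \<open>ds / s\<close>.\<close>
    have 2: "\<bar>g' s\<bar> / g s = 1 / s" using s r by (simp add: g_def g'_def field_simps power2_eq_square)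
    have "(4 * pi * g s) powr (- ?a) = (pi * r\<^sup>2 / s) powr (- ?a)" by (simp add: g_def field_simps)
    also have "\<dots> = (s / (pi * r\<^sup>2)) powr ?a"
      using s r by (simp add: powr_minus powr_divide field_simps)
    also have "\<dots> = pi powr (- ?a) * s powr ?a / (r\<^sup>2) powr ?a"
      using s r by (simp add: powr_divide powr_mult powr_minus field_simps)
    also have "(r\<^sup>2) powr ?a = r ^ DIM('a)"
    proof -
      have "r\<^sup>2 = r powr 2" using r by simp
      then have "(r\<^sup>2) powr ?a = r powr real DIM('a)" by (simp only: powr_powr) simp
      then show ?thesis using r by (simp add: powr_realpow)
    qed
    finally have 3: "(4 * pi * g s) powr (- ?a) = pi powr (- ?a) * s powr ?a / r ^ DIM('a)" .
    have "\<bar>g' s\<bar> * ?f (g s) = \<bar>g' s\<bar> / g s * ((4 * pi * g s) powr (- ?a) * exp (- ((norm z)\<^sup>2 / (4 * g s))))"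
      by (simp add: heat_kernel_def)
    also have "\<dots> = 1 / s * (pi powr (- ?a) * s powr ?a / r ^ DIM('a) * exp (- s))"
      unfolding 1 2 3 ..
    also have "s powr ?a = s * s powr (?a - 1)"
      using s powr_mult_base[of s "?a - 1"] by simp
    also have "1 / s * (pi powr (- ?a) * (s * s powr (?a - 1)) / r ^ DIM('a) * exp (- s)) = C * gamma_density ?a s"
      using s Gamma_real_pos[OF a] less_imp_neq[OF Gamma_real_pos[OF a]] by (simp add: C_def c_const_def gamma_density_def)
    finally show ?thesis .
  qed
  have int: "has_bochner_integral lborel (\<lambda>s. indicator {0<..} s *\<^sub>R (\<bar>g' s\<bar> * ?f (g s))) C"
  proof -
    have "has_bochner_integral lborel (\<lambda>s. C * gamma_density ?a s) (C * 1)"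
      by (intro has_bochner_integral_mult_right has_bochner_integral_gamma_density a)
    moreover have "C * gamma_density ?a s = indicator {0<..} s *\<^sub>R (\<bar>g' s\<bar> * ?f (g s))" for s
      using eq[of s] by (auto simp: gamma_density_def indicator_def)
    ultimately show ?thesis by simp
  qed
  \<comment> \<open>The change of variables is carried out over \<open>lebesgue\<close>, the
    completion of \<open>lborel\<close>; Borel measurability allows the passage there and, at the
    end, back.\<close>
  have si: "set_integrable lebesgue {0<..} (\<lambda>s. \<bar>g' s\<bar> * ?f (g s))"
    and sI: "set_lebesgue_integral lebesgue {0<..} (\<lambda>s. \<bar>g' s\<bar> * ?f (g s)) = C"
    using int unfolding set_integrable_def set_lebesgue_integral_def has_bochner_integral_iff
    by (auto simp: integrable_completion integral_completion g_def[abs_def] g'_def[abs_def])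
  have "(?f absolutely_integrable_on (g ` {0<..}) \<and> integral (g ` {0<..}) ?f = C)"
    using si sI set_lebesgue_integral_eq_integral(2)[OF si]
    by (subst has_absolute_integral_change_of_variables_1'[OF _ der inj, symmetric]) auto
  then have fi: "set_integrable lebesgue {0<..} ?f" and fI: "integral {0<..} ?f = C"
    unfolding img by auto
  have "set_lebesgue_integral lebesgue {0<..} ?f = C"
    using set_lebesgue_integral_eq_integral(2)[OF fi] fI by simp
  then have "has_bochner_integral lborel (\<lambda>t. indicator {0<..} t *\<^sub>R ?f t) C"
    using fi unfolding set_integrable_def set_lebesgue_integral_def has_bochner_integral_iff
    by (simp add: integrable_completion integral_completion)
  then show ?thesis by (simp add: C_def r_def)
qed

section \<open>Fubini, layers of the logarithm and the constant \<open>rho_const\<close>\<close>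

text \<open>Suited to integrands whose inner integral \<open>I\<close> and inner absolute integral
  \<open>N\<close> are known in closed form: integrability on the product then reduces to that of
  \<open>N\<close>.\<close>

lemma (in pair_sigma_finite) has_bochner_integral_Fubini:
  fixes F :: "'a \<Rightarrow> 'b \<Rightarrow> real"
  assumes F [measurable]: "case_prod F \<in> borel_measurable (M1 \<Otimes>\<^sub>M M2)"
    and I: "\<And>x. has_bochner_integral M2 (F x) (I x)"
    and N: "\<And>x. (\<integral>y. \<bar>F x y\<bar> \<partial>M2) = N x" "integrable M1 N"
  shows "has_bochner_integral M2 (\<lambda>y. \<integral>x. F x y \<partial>M1) (\<integral>x. I x \<partial>M1)"
proof -
  have int: "integrable (M1 \<Otimes>\<^sub>M M2) (case_prod F)"
  proof (rule Fubini_integrable[OF F])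
    show "integrable M1 (\<lambda>x. \<integral>y. norm (case (x, y) of (x, y) \<Rightarrow> F x y) \<partial>M2)"
      using N by simp
    show "AE x in M1. integrable M2 (\<lambda>y. case (x, y) of (x, y) \<Rightarrow> F x y)"
      using I by (simp add: has_bochner_integral_iff)
  qed
  have "(\<integral>y. F x y \<partial>M2) = I x" for x using I by (simp add: has_bochner_integral_iff)
  with Fubini_integral[OF int] integrable_snd[OF int] show ?thesis
    by (simp add: has_bochner_integral_iff)
qed

lemma has_bochner_integral_inverse_Ico:
  assumes "0 < p" "p \<le> (q::real)"
  shows "has_bochner_integral lborel (\<lambda>t. indicator {p..<q} t / t) (ln q - ln p)"
proof -
  have "has_bochner_integral lborel (\<lambda>t. (1 / t) * indicator {p..q} t) (ln q - ln p)"
    using assms by (intro has_bochner_integral_FTC_Icc_nonneg) (auto intro!: derivative_eq_intros)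
  then show ?thesis
    by (rule has_bochner_integral_cong_AE[THEN iffD1, rotated -1])
       (use AE_lborel_singleton[of q] in \<open>auto simp: indicator_def elim!: eventually_mono\<close>)
qed

text \<open>The integrand has constant sign: it is \<open>1 / t\<close> on \<open>{1..<x}\<close> or
  \<open>- 1 / t\<close> on \<open>{x..<1}\<close>. Hence the absolute integral is
  \<open>\<bar>ln x\<bar>\<close>, the bound that Fubini requires.\<close>

lemma has_bochner_integral_ln_layers:
  assumes x: "x > (0::real)"
  defines "l \<equiv> \<lambda>t. indicator {0<..} t * (((if t < x then 1 else 0) - (if t < 1 then 1 else 0)) / t)"
  shows "has_bochner_integral lborel l (ln x)"
    and "(LINT t|lborel. \<bar>l t\<bar>) = \<bar>ln x\<bar>"
proof -
  have "has_bochner_integral lborel l (ln x) \<and> (LINT t|lborel. \<bar>l t\<bar>) = \<bar>ln x\<bar>"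
  proof (cases "x \<ge> 1")
    case True
    have "l = (\<lambda>t. indicator {1..<x} t / t)" "(\<lambda>t. \<bar>l t\<bar>) = (\<lambda>t. indicator {1..<x} t / t)"
      using True by (auto simp: l_def indicator_def fun_eq_iff)
    with has_bochner_integral_inverse_Ico[of 1 x] True show ?thesis
      by (simp add: has_bochner_integral_iff)
  next
    case False
    have "l = (\<lambda>t. - (indicator {x..<1} t / t))" "(\<lambda>t. \<bar>l t\<bar>) = (\<lambda>t. indicator {x..<1} t / t)"
      using False x by (auto simp: l_def indicator_def fun_eq_iff)
    with has_bochner_integral_inverse_Ico[of x 1] False x show ?thesis
      by (simp add: has_bochner_integral_iff)
  qed
  then show "has_bochner_integral lborel l (ln x)" "(LINT t|lborel. \<bar>l t\<bar>) = \<bar>ln x\<bar>" by auto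
qed

text \<open>The layer formula for \<open>ln (X s)\<close> is averaged against \<open>p\<close> and
  the integrals are exchanged; averaging the layer \<open>t < X s\<close> gives the tail of
  \<open>X\<close>. Absolute integrability is exactly that of \<open>p s * ln (X s)\<close>.\<close>

lemma has_bochner_integral_tail_ln:
  fixes p X :: "real \<Rightarrow> real"
  assumes p: "has_bochner_integral lborel p 1"
    and X [measurable]: "X \<in> borel_measurable borel"
    and pos: "\<And>s. p s \<noteq> 0 \<Longrightarrow> X s > 0"
    and L: "has_bochner_integral lborel (\<lambda>s. p s * ln (X s)) L"
  shows "has_bochner_integral lborel (\<lambda>t. indicator {0<..} t *
    (((LINT s|lborel. p s * (if t < X s then 1 else 0)) - (if t < 1 then 1 else 0)) / t)) L"
proof -
  have p_int: "integrable lborel p" and p1: "(LINT s|lborel. p s) = 1"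
    using p by (auto simp: has_bochner_integral_iff)
  from p_int have [measurable]: "p \<in> borel_measurable borel" by auto
  let ?l = "\<lambda>s t. indicator {0<..} t * (((if t < X s then 1 else 0) - (if t < 1 then 1 else 0)) / t)"
  let ?F = "\<lambda>s t. p s * ?l s t"
  have "has_bochner_integral lborel (\<lambda>t. LINT s|lborel. ?F s t) (LINT s|lborel. p s * ln (X s))"
  proof (rule lborel_pair.has_bochner_integral_Fubini)
    show "(\<lambda>(s, t). ?F s t) \<in> borel_measurable (lborel \<Otimes>\<^sub>M lborel)"
      by measurable
    \<comment> \<open>Where \<open>p s = 0\<close> the value \<open>X s\<close> may fail to be
      positive, but then the integrand vanishes.\<close>
    show "has_bochner_integral lborel (?F s) (p s * ln (X s))" for s
    proof (cases "p s = 0")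
      case False
      then show ?thesis by (intro has_bochner_integral_mult_right has_bochner_integral_ln_layers pos)
    qed (simp add: has_bochner_integral_zero)
    show "(LINT t|lborel. \<bar>?F s t\<bar>) = \<bar>p s * ln (X s)\<bar>" for s
    proof (cases "p s = 0")
      case False
      then have "(LINT t|lborel. \<bar>?l s t\<bar>) = \<bar>ln (X s)\<bar>"
        by (intro has_bochner_integral_ln_layers pos)
      moreover have "\<bar>?F s t\<bar> = \<bar>p s\<bar> * \<bar>?l s t\<bar>" for t by (rule abs_mult)
      ultimately show ?thesis by (simp only: integral_mult_right_zero abs_mult)
    qed simp
    show "integrable lborel (\<lambda>s. \<bar>p s * ln (X s)\<bar>)"
      using L by (simp add: has_bochner_integral_iff)
  qed
  moreover have "(LINT s|lborel. ?F s t) = indicator {0<..} t *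
    (((LINT s|lborel. p s * (if t < X s then 1 else 0)) - (if t < 1 then 1 else 0)) / t)" for t
  proof -
    have int: "integrable lborel (\<lambda>s. p s * (if t < X s then 1 else 0))"
      by (rule Bochner_Integration.integrable_bound[OF p_int]) auto
    have "?F s t = indicator {0<..} t * ((p s * (if t < X s then 1 else 0) - p s * (if t < 1 then 1 else 0)) / t)" for s
      by (simp add: field_simps)
    then have "(LINT s|lborel. ?F s t) = (LINT s|lborel. indicator {0<..} t * ((p s * (if t < X s then 1 else 0) - p s * (if t < 1 then 1 else 0)) / t))"
      by (rule Bochner_Integration.integral_cong[OF refl])
    also have "\<dots> = indicator {0<..} t *
      (((LINT s|lborel. p s * (if t < X s then 1 else 0)) - (LINT s|lborel. p s * (if t < 1 then 1 else 0))) / t)"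
      using int p_int by (simp only: integral_mult_right_zero integral_divide_zero
        Bochner_Integration.integral_diff integrable_mult_left)
    \<comment> \<open>The layer \<open>t < 1\<close> is independent of \<open>s\<close> and comes
      out unchanged because \<open>p\<close> has mass one.\<close>
    finally show ?thesis using p1 by (simp only: integral_mult_left_zero mult_1)
  qed
  moreover have "(LINT s|lborel. p s * ln (X s)) = L" using L by (simp add: has_bochner_integral_iff)
  ultimately show ?thesis by (simp only:)
qed

text \<open>Shape 1 is the exponential law, so \<open>exp (- t)\<close> is a tail of the same kind
  as the heat mass of the ball. The endpoint \<open>s = t\<close> is a null set.\<close>

lemma exponential_tail:
  assumes t: "t > 0"
  shows "(LINT s|lborel. gamma_density 1 s * (if t < s then 1 else 0)) = exp (- t)"
proof -
  have "((\<lambda>s. exp (- 1 * s)) has_integral exp (- 1 * t) / 1) {t..}"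
    by (rule has_integral_exp_minus_to_infinity) simp
  then have "((\<lambda>s. if s \<in> {t..} then exp (- s) else 0) has_integral exp (- t)) UNIV"
    by (subst has_integral_restrict_UNIV) simp
  then have "integral\<^sup>N lborel (\<lambda>s. if s \<in> {t..} then exp (- s) else 0) = ennreal (exp (- t))"
    by (intro nn_integral_has_integral_lborel) auto
  then have *: "has_bochner_integral lborel (\<lambda>s. if s \<in> {t..} then exp (- s) else 0) (exp (- t))"
    by (intro has_bochner_integral_nn_integral) auto
  have "(LINT s|lborel. gamma_density 1 s * (if t < s then 1 else 0)) =
        (LINT s|lborel. (if s \<in> {t..} then exp (- s) else 0))"
    using AE_lborel_singleton[of t] t
    by (intro integral_cong_AE) (auto simp: gamma_density_def indicator_def elim!: eventually_mono)
  with * show ?thesis by (simp add: has_bochner_integral_iff)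
qed

text \<open>Neither \<open>exp (- t) / t\<close> nor the heat mass over \<open>t\<close> is
  integrable near 0. Each becomes integrable after the same layer \<open>t < 1\<close> is
  subtracted, and these layers cancel in the difference of the two tail formulas.\<close>

lemma has_bochner_integral_rho_const:
  fixes x :: "'a::euclidean_space"
  shows "has_bochner_integral lborel (\<lambda>t. indicator {0<..} t *
    ((exp (- t) - (LINT y|lborel. heat_kernel t (x - y) * indicator (ball x 1) y)) / t)) (rho_const DIM('a))"
proof -
  define a where "a = real DIM('a) / 2"
  have a: "a > 0" by (simp add: a_def)
  define P where "P t = (LINT s|lborel. gamma_density a s * (if t < 1 / (4 * s) then 1 else 0))" for t
  define E where "E t = (LINT s|lborel. gamma_density 1 s * (if t < s then 1 else 0))" for t
  let ?o = "\<lambda>t::real. (if t < 1 then 1 else 0) :: real"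
  have E: "has_bochner_integral lborel (\<lambda>t. indicator {0<..} t * ((E t - ?o t) / t)) (Digamma 1)"
    unfolding E_def
    by (rule has_bochner_integral_tail_ln[OF has_bochner_integral_gamma_density _ _ has_bochner_integral_gamma_density_ln])
       (auto dest: gamma_density_support)
  have "has_bochner_integral lborel (\<lambda>s. - (ln 4 * gamma_density a s) - gamma_density a s * ln s) (- (ln 4 * 1) - Digamma a)"
    by (intro has_bochner_integral_diff has_bochner_integral_minus has_bochner_integral_mult_right
        has_bochner_integral_gamma_density has_bochner_integral_gamma_density_ln a)
  moreover have "- (ln 4 * gamma_density a s) - gamma_density a s * ln s = gamma_density a s * ln (1 / (4 * s))" for s
  proof (cases "s > 0")
    case True
    then have ln: "ln (1 / (4 * s)) = - ln 4 - ln s" by (simp add: ln_div ln_mult)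
    show ?thesis unfolding ln by (simp add: algebra_simps)
  qed (simp add: gamma_density_def)
  ultimately have "has_bochner_integral lborel (\<lambda>s. gamma_density a s * ln (1 / (4 * s))) (- ln 4 - Digamma a)"
    by (simp only: mult_1_right)
  from has_bochner_integral_tail_ln[OF has_bochner_integral_gamma_density[OF a] _ _ this]
  have P: "has_bochner_integral lborel (\<lambda>t. indicator {0<..} t * ((P t - ?o t) / t)) (- ln 4 - Digamma a)"
    unfolding P_def by (auto dest: gamma_density_support)
  \<comment> \<open>The term \<open>2 * ln 2\<close> comes from the 4 in \<open>1 / (4 * s)\<close>,
    and \<open>- euler_mascheroni\<close> is \<open>Digamma 1\<close>.\<close>
  have "ln (4::real) = 2 * ln 2" using ln_realpow[of 2 2] by simp
  then have rho: "Digamma 1 - (- ln 4 - Digamma a) = rho_const DIM('a)"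
    by (simp add: rho_const_def a_def)
  have "indicator {0<..} t * ((E t - ?o t) / t) - indicator {0<..} t * ((P t - ?o t) / t) =
    indicator {0<..} t * ((exp (- t) - (LINT y|lborel. heat_kernel t (x - y) * indicator (ball x 1) y)) / t)" for t
  proof (cases "t > 0")
    case True
    \<comment> \<open>The indicator of the unit ball as a function of the variable
      \<open>(norm (x - y))\<^sup>2 / (4 * t)\<close>.\<close>
    define g where "g s = (if s < 1 / (4 * t) then 1 else 0 :: real)" for s
    have [measurable]: "g \<in> borel_measurable borel" unfolding g_def[abs_def] by measurable
    have g: "g ((norm (x - y))\<^sup>2 / (4 * t)) = indicator (ball x 1) y" for y
      using True by (simp add: g_def indicator_def dist_norm divide_less_cancel abs_square_less_1)
    \<comment> \<open>On the support \<open>s > 0\<close> the inequality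
      \<open>s < 1 / (4 * t)\<close> is solved for \<open>t\<close>, so that the mass of the ball
      becomes the tail of \<open>1 / (4 * s)\<close>.\<close>
    have "gamma_density a s * g s = gamma_density a s * (if t < 1 / (4 * s) then 1 else 0)" for s
      using True by (auto simp: g_def gamma_density_def indicator_def field_simps)
    moreover have "integrable lborel (\<lambda>s. gamma_density a s * g s)"
      by (rule Bochner_Integration.integrable_bound[OF integrable.intros[OF has_bochner_integral_gamma_density[OF a]]])
        (auto simp: g_def)
    ultimately have "has_bochner_integral lborel (\<lambda>s. gamma_density a s * g s) (P t)"
      unfolding P_def has_bochner_integral_iff by (simp only: simp_thms)
    then have "has_bochner_integral lborel (\<lambda>y. heat_kernel t (x - y) * g ((norm (x - y))\<^sup>2 / (4 * t))) (P t)"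
      unfolding a_def by (subst has_bochner_integral_heat_kernel_radial_iff[OF True]) simp_all
    then have "has_bochner_integral lborel (\<lambda>y. heat_kernel t (x - y) * indicator (ball x 1) y) (P t)"
      by (simp only: g)
    then show ?thesis
      using True exponential_tail[OF True] by (simp add: has_bochner_integral_iff E_def diff_divide_distrib)
  qed simp
  with has_bochner_integral_diff[OF E P] show ?thesis by (simp only: rho)
qed

section \<open>Exchange of time and space integrals; integrability at the singularity\<close>

text \<open>Fubini with the time integral inside. At \<open>y = x\<close> the kernel is not
  integrable in time; \<open>G x = 0\<close> removes this point. As the kernel is nonnegative, the
  absolute inner integral is the absolute value of the inner integral.\<close>

lemma has_bochner_integral_heat_Fubini:
  fixes x :: "'a::euclidean_space" and G :: "'a \<Rightarrow> real"
  assumes [measurable]: "G \<in> borel_measurable borel" and Gx: "G x = 0"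
    and int: "integrable lborel (\<lambda>y. G y / norm (x - y) ^ DIM('a))"
  shows "has_bochner_integral lborel
    (\<lambda>t. indicator {0<..} t * ((LINT y|lborel. heat_kernel t (x - y) * G y) / t))
    (c_const DIM('a) * (LINT y|lborel. G y / norm (x - y) ^ DIM('a)))"
proof -
  let ?k = "\<lambda>y t. indicator {0<..} t * (heat_kernel t (x - y) / t)"
  let ?F = "\<lambda>y t. ?k y t * G y"
  let ?I = "\<lambda>y. c_const DIM('a) / norm (x - y) ^ DIM('a) * G y"
  have c: "c_const DIM('a) \<ge> 0" using Gamma_real_pos[of "real DIM('a) / 2"] by (simp add: c_const_def)
  have k: "has_bochner_integral lborel (?k y) (c_const DIM('a) / norm (x - y) ^ DIM('a))" if "G y \<noteq> 0" for y
    using that Gx by (intro has_bochner_integral_heat_kernel_time) auto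
  have "has_bochner_integral lborel (\<lambda>t. LINT y|lborel. ?F y t) (LINT y|lborel. ?I y)"
  proof (rule lborel_pair.has_bochner_integral_Fubini)
    show "(\<lambda>(y, t). ?F y t) \<in> borel_measurable (lborel \<Otimes>\<^sub>M lborel)" by measurable
    show "has_bochner_integral lborel (?F y) (?I y)" for y
      by (rule has_bochner_integral_mult_left) (rule k)
    show "(LINT t|lborel. \<bar>?F y t\<bar>) = \<bar>?I y\<bar>" for y
    proof (cases "G y = 0")
      case False
      have "\<bar>?F y t\<bar> = ?k y t * \<bar>G y\<bar>" for t
        by (auto simp: abs_mult indicator_def heat_kernel_nonneg)
      then have "(LINT t|lborel. \<bar>?F y t\<bar>) = (LINT t|lborel. ?k y t * \<bar>G y\<bar>)"
        by (rule Bochner_Integration.integral_cong[OF refl])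
      also have "\<dots> = (LINT t|lborel. ?k y t) * \<bar>G y\<bar>"
        by (rule integral_mult_left_zero)
      also have "(LINT t|lborel. ?k y t) = \<bar>c_const DIM('a) / norm (x - y) ^ DIM('a)\<bar>"
        using k[OF False] c by (simp add: has_bochner_integral_iff)
      finally show ?thesis unfolding abs_mult .
    qed simp
    have "integrable lborel (\<lambda>y. \<bar>c_const DIM('a) * (G y / norm (x - y) ^ DIM('a))\<bar>)"
      using int by (intro integrable_abs integrable_mult_right)
    then show "integrable lborel (\<lambda>y. \<bar>?I y\<bar>)" by simp
  qed
  moreover have "(LINT y|lborel. ?F y t) = indicator {0<..} t * ((LINT y|lborel. heat_kernel t (x - y) * G y) / t)" for t
  proof -
    have "?F y t = indicator {0<..} t * ((heat_kernel t (x - y) * G y) / t)" for y by simp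
    then show ?thesis by (simp only: integral_mult_right_zero integral_divide_zero)
  qed
  moreover have "(LINT y|lborel. ?I y) = c_const DIM('a) * (LINT y|lborel. G y / norm (x - y) ^ DIM('a))"
  proof -
    have "?I y = c_const DIM('a) * (G y / norm (x - y) ^ DIM('a))" for y by simp
    then show ?thesis by (simp only: integral_mult_right_zero)
  qed
  ultimately show ?thesis by (simp only:)
qed

text \<open>In the variable \<open>s = (norm (x - y))\<^sup>2\<close> the integrand times the radial
  density is a multiple of \<open>s powr (\<alpha> / 2 - 1)\<close> on
  \<open>{0<..<1}\<close>.\<close>

lemma integrable_ball_powr:
  fixes x :: "'a::euclidean_space"
  assumes "\<alpha> > 0"
  shows "integrable lborel (\<lambda>y. indicator (ball x 1) y * (norm (x - y) powr \<alpha> / norm (x - y) ^ DIM('a)))"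
proof -
  define a where "a = real DIM('a) / 2"
  let ?A = "(pi * 1) powr a / Gamma a"
  let ?g = "\<lambda>s. (if s < 1 then 1 else 0) * s powr (\<alpha> / 2 - a) :: real"
  have pw: "(r\<^sup>2) powr (b / 2) = r powr b" if "r \<ge> 0" for r b :: real
    using that by (cases "r = 0") (simp_all add: powr_powr flip: powr_numeral)
  have "has_bochner_integral lborel (\<lambda>s. ?A * (indicator {0<..<1} s * s powr (\<alpha> / 2 - 1))) (?A * (1 powr (\<alpha> / 2) / (\<alpha> / 2)))"
    using assms by (intro has_bochner_integral_mult_right has_bochner_integral_powr_from_0) auto
  moreover have "?A * (indicator {0<..<1} s * s powr (\<alpha> / 2 - 1)) =
    indicator {0<..} s * (?A * s powr (a - 1)) * ?g s" for s
    by (auto simp: indicator_def powr_add[symmetric])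
  ultimately have "has_bochner_integral lborel (\<lambda>s. indicator {0<..} s * (?A * s powr (a - 1)) * ?g s)
    (?A * (1 powr (\<alpha> / 2) / (\<alpha> / 2)))"
    by (simp only:)
  moreover have "?g \<in> borel_measurable borel" by measurable
  ultimately have "has_bochner_integral lborel (\<lambda>y::'a. ?g ((norm (x - y))\<^sup>2 / 1)) (?A * (1 powr (\<alpha> / 2) / (\<alpha> / 2)))"
    using has_bochner_integral_radial_iff[of 1 ?g x, OF zero_less_one, folded a_def] by blast
  moreover have "?g ((norm (x - y))\<^sup>2 / 1) = indicator (ball x 1) y * (norm (x - y) powr \<alpha> / norm (x - y) ^ DIM('a))" for y
  proof -
    have "((norm (x - y))\<^sup>2) powr (\<alpha> / 2 - a) = norm (x - y) powr (\<alpha> - real DIM('a))"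
      using pw[of "norm (x - y)" "\<alpha> - real DIM('a)"] by (simp add: a_def diff_divide_distrib)
    \<comment> \<open>At \<open>x = y\<close> both sides are 0, since \<open>0 powr\<close> anything
      and division by 0 are 0.\<close>
    also have "\<dots> = norm (x - y) powr \<alpha> / norm (x - y) ^ DIM('a)"
      by (cases "x = y") (simp_all add: powr_diff powr_realpow)
    finally show ?thesis by (simp add: indicator_def dist_norm abs_square_less_1)
  qed
  ultimately show ?thesis by (simp only: has_bochner_integral_iff)
qed

section \<open>Splitting the semigroup and conclusion\<close>

lemma heat_semigroup_eq: "heat_semigroup t f x = (LINT y|lborel. heat_kernel t (x - y) * f y)"
  by (simp add: heat_semigroup_def heat_kernel_def mult.assoc)

lemma set_has_bochner_integral_iff:
  "has_bochner_integral M (\<lambda>x. indicator A x * g x) (I :: real) \<longleftrightarrow>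
    set_integrable M A g \<and> (LINT x:A|M. g x) = I"
  by (simp add: has_bochner_integral_iff set_integrable_def set_lebesgue_integral_def)

theorem theorem2:
  fixes f :: "'a::euclidean_space \<Rightarrow> real" and \<beta> :: real and x :: 'a
  assumes beta_pos: "\<beta> > 0"
    and holder: "\<exists>C. \<forall>y z. \<bar>f y - f z\<bar> \<le> C * dist y z powr (min \<beta> 1)"
    and compact_supp: "compact (closure {y. f y \<noteq> 0})"
  shows "set_integrable lborel {0<..}
           (\<lambda>t::real. (exp (- t) * f x - heat_semigroup t f x) / t) \<and>
         set_integrable lborel (ball x 1) (\<lambda>y. (f x - f y) / norm (x - y) ^ DIM('a)) \<and>
         set_integrable lborel (- ball x 1) (\<lambda>y. f y / norm (x - y) ^ DIM('a)) \<and>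
         (LINT t:{0<..}|lborel. (exp (- t) * f x - heat_semigroup t f x) / t)
         = c_const DIM('a) * (LINT y:ball x 1|lborel. (f x - f y) / norm (x - y) ^ DIM('a))
           - c_const DIM('a) * (LINT y:(- ball x 1)|lborel. f y / norm (x - y) ^ DIM('a))
           + rho_const DIM('a) * f x"
proof -
  define \<alpha> where "\<alpha> = min \<beta> 1"
  have \<alpha>: "\<alpha> > 0" using beta_pos by (simp add: \<alpha>_def)
  obtain C where C: "\<bar>f y - f z\<bar> \<le> C * dist y z powr \<alpha>" for y z
    using holder unfolding \<alpha>_def by blast
  have cont: "continuous_on UNIV f"
    unfolding continuous_on_def
  proof
    fix y :: 'a
    have "((\<lambda>z. C * dist z y powr \<alpha>) \<longlongrightarrow> C * dist y y powr \<alpha>) (at y)"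
      using \<alpha> by (intro tendsto_intros) auto
    then have "((\<lambda>z. C * dist z y powr \<alpha>) \<longlongrightarrow> 0) (at y)" using \<alpha> by simp
    then have "((\<lambda>z. f z - f y) \<longlongrightarrow> 0) (at y)"
      by (rule Lim_null_comparison[rotated]) (use C in auto)
    then show "(f \<longlongrightarrow> f y) (at y within UNIV)" by (simp add: LIM_zero_iff)
  qed
  then have f_meas [measurable]: "f \<in> borel_measurable borel"
    by (rule borel_measurable_continuous_onI)
  let ?S = "closure {y. f y \<noteq> 0}"
  have f_out: "f y = 0" if "y \<notin> ?S" for y using that closure_subset[of "{y. f y \<noteq> 0}"] by auto
  obtain B where B: "\<bar>f y\<bar> \<le> B" for y
  proof -
    have "bounded (f ` ?S)"
      using compact_supp cont by (intro compact_imp_bounded compact_continuous_image) (auto intro: continuous_on_subset)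
    then obtain b where b: "\<bar>f y\<bar> \<le> b" if "y \<in> ?S" for y by (auto simp: bounded_iff)
    have "\<bar>f y\<bar> \<le> max b 0" for y
      using b[of y] f_out[of y] by (cases "y \<in> ?S") auto
    then show ?thesis by (rule that)
  qed
  have f_int: "integrable lborel f"
  proof (rule Bochner_Integration.integrable_bound)
    show "integrable lborel (\<lambda>y. B * indicator ?S y)"
      using emeasure_bounded_finite[OF compact_imp_bounded[OF compact_supp]]
      by (intro integrable_mult_right integrable_real_indicator) auto
    show "AE y in lborel. norm (f y) \<le> norm (B * indicator ?S y)"
    proof (rule AE_I2)
      show "norm (f y) \<le> norm (B * indicator ?S y)" for y
        using B[of y] f_out[of y] by (cases "y \<in> ?S") auto
    qed
  qed auto
  \<comment> \<open>Subtracting \<open>f x\<close> inside the ball tames the singularity of the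
    kernel. Both functions vanish at \<open>x\<close>, as the exchange of integrals demands.\<close>
  define G1 where "G1 y = indicator (ball x 1) y * (f x - f y)" for y
  define G2 where "G2 y = indicator (- ball x 1) y * f y" for y
  have [measurable]: "G1 \<in> borel_measurable borel" "G2 \<in> borel_measurable borel"
    unfolding G1_def[abs_def] G2_def[abs_def]
    by (intro borel_measurable_times borel_measurable_diff borel_measurable_indicator f_meas; simp)+
  \<comment> \<open>The Hoelder bound improves the singularity from order \<open>n\<close> to order
    \<open>n - \<alpha>\<close>.\<close>
  have G1_int: "integrable lborel (\<lambda>y. G1 y / norm (x - y) ^ DIM('a))"
  proof (rule Bochner_Integration.integrable_bound)
    show "integrable lborel (\<lambda>y. C * (indicator (ball x 1) y * (norm (x - y) powr \<alpha> / norm (x - y) ^ DIM('a))))"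
      by (intro integrable_mult_right integrable_ball_powr \<alpha>)
    have bound: "\<bar>G1 y\<bar> / norm (x - y) ^ DIM('a) \<le> C * (indicator (ball x 1) y * (norm (x - y) powr \<alpha> / norm (x - y) ^ DIM('a)))" for y
      using C[of x y] by (auto simp: G1_def indicator_def dist_norm intro!: divide_right_mono)
    show "AE y in lborel. norm (G1 y / norm (x - y) ^ DIM('a)) \<le>
      norm (C * (indicator (ball x 1) y * (norm (x - y) powr \<alpha> / norm (x - y) ^ DIM('a))))"
      by (rule AE_I2) (simp only: real_norm_def abs_divide power_abs abs_norm_cancel order_trans[OF bound abs_ge_self])
  qed measurable
  \<comment> \<open>Off the ball the denominator is at least 1, so \<open>f\<close> itself is a
    majorant.\<close>
  have G2_int: "integrable lborel (\<lambda>y. G2 y / norm (x - y) ^ DIM('a))"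
  proof (rule Bochner_Integration.integrable_bound[OF f_int])
    have "\<bar>G2 y\<bar> / norm (x - y) ^ DIM('a) \<le> \<bar>f y\<bar>" for y
    proof (cases "y \<in> ball x 1")
      case False
      then have "norm (x - y) ^ DIM('a) \<ge> 1" by (simp add: dist_norm one_le_power)
      then have "\<bar>f y\<bar> / norm (x - y) ^ DIM('a) \<le> \<bar>f y\<bar> / 1"
        by (intro divide_left_mono) auto
      then show ?thesis using False by (simp add: G2_def)
    qed (simp add: G2_def)
    then show "AE y in lborel. norm (G2 y / norm (x - y) ^ DIM('a)) \<le> norm (f y)"
      by simp
  qed measurable
  let ?H = "\<lambda>t G. LINT y|lborel. heat_kernel t (x - y) * G y"
  let ?I1 = "LINT y|lborel. G1 y / norm (x - y) ^ DIM('a)"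
  let ?I2 = "LINT y|lborel. G2 y / norm (x - y) ^ DIM('a)"
  have H1: "has_bochner_integral lborel (\<lambda>t. indicator {0<..} t * (?H t G1 / t)) (c_const DIM('a) * ?I1)"
    by (intro has_bochner_integral_heat_Fubini G1_int) (measurable, simp add: G1_def)
  have H2: "has_bochner_integral lborel (\<lambda>t. indicator {0<..} t * (?H t G2 / t)) (c_const DIM('a) * ?I2)"
    by (intro has_bochner_integral_heat_Fubini G2_int) (measurable, simp add: G2_def)
  have H3: "has_bochner_integral lborel (\<lambda>t. indicator {0<..} t * ((exp (- t) - ?H t (indicator (ball x 1))) / t) * f x)
    (rho_const DIM('a) * f x)"
    by (intro has_bochner_integral_mult_left has_bochner_integral_rho_const)
  \<comment> \<open>Inside the ball \<open>f y\<close> is written as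
    \<open>f x - (f x - f y)\<close>; the part with \<open>f x\<close> is the heat mass of the ball,
    which joins \<open>exp (- t)\<close>.\<close>
  have split: "exp (- t) * f x - heat_semigroup t f x =
    ?H t G1 - ?H t G2 + (exp (- t) - ?H t (indicator (ball x 1))) * f x" if t: "t > 0" for t
  proof -
    have k: "integrable lborel (\<lambda>y. heat_kernel t (x - y))"
      using has_bochner_integral_heat_kernel[OF t, of x] by (simp add: has_bochner_integral_iff)
    have i1: "integrable lborel (\<lambda>y. heat_kernel t (x - y) * indicator (ball x 1) y)"
      by (rule Bochner_Integration.integrable_bound[OF k]) (auto simp: indicator_def)
    have kB: "integrable lborel (\<lambda>y. B * heat_kernel t (x - y))" using k by simp
    \<comment> \<open>One bound, \<open>B\<close> times the kernel, serves the weights of the ball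
      and of its complement.\<close>
    have kf: "integrable lborel (\<lambda>y. heat_kernel t (x - y) * (g y * f y))"
      if [measurable]: "g \<in> borel_measurable borel" and g: "\<And>y. \<bar>g y\<bar> \<le> 1" for g
    proof (rule Bochner_Integration.integrable_bound[OF kB])
      have "\<bar>g y\<bar> * \<bar>f y\<bar> \<le> B" for y using mult_mono[OF g[of y] B[of y]] by simp
      then have bound: "heat_kernel t (x - y) * (\<bar>g y\<bar> * \<bar>f y\<bar>) \<le> B * heat_kernel t (x - y)" for y
        by (subst mult.commute) (intro mult_right_mono heat_kernel_nonneg)
      show "AE y in lborel. norm (heat_kernel t (x - y) * (g y * f y)) \<le> norm (B * heat_kernel t (x - y))"
      proof (rule AE_I2)
        show "norm (heat_kernel t (x - y) * (g y * f y)) \<le> norm (B * heat_kernel t (x - y))" for y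
          using order_trans[OF bound abs_ge_self, of y] by (simp add: abs_mult heat_kernel_nonneg)
      qed
    qed measurable
    have i2: "integrable lborel (\<lambda>y. heat_kernel t (x - y) * (indicator (ball x 1) y * f y))"
      and i3: "integrable lborel (\<lambda>y. heat_kernel t (x - y) * (indicator (- ball x 1) y * f y))"
      by (intro kf; auto simp: indicator_def)+
    have "heat_semigroup t f x = (LINT y|lborel. heat_kernel t (x - y) * (indicator (ball x 1) y * f y)
        + heat_kernel t (x - y) * (indicator (- ball x 1) y * f y))"
      unfolding heat_semigroup_eq by (intro Bochner_Integration.integral_cong) (auto simp: indicator_def)
    also have "\<dots> = (LINT y|lborel. heat_kernel t (x - y) * (indicator (ball x 1) y * f y)) + ?H t G2"
      unfolding G2_def using i2 i3 by simp
    finally have "heat_semigroup t f x = (LINT y|lborel. heat_kernel t (x - y) * (indicator (ball x 1) y * f y)) + ?H t G2" .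
    moreover have "?H t G1 = (LINT y|lborel. heat_kernel t (x - y) * indicator (ball x 1) y * f x
        - heat_kernel t (x - y) * (indicator (ball x 1) y * f y))"
      unfolding G1_def by (intro Bochner_Integration.integral_cong) (auto simp: algebra_simps)
    moreover have "\<dots> = ?H t (indicator (ball x 1)) * f x
        - (LINT y|lborel. heat_kernel t (x - y) * (indicator (ball x 1) y * f y))"
      by (subst Bochner_Integration.integral_diff[OF integrable_mult_left[OF i1] i2])
         (simp only: integral_mult_left_zero)
    ultimately show ?thesis by (simp add: algebra_simps)
  qed
  have "has_bochner_integral lborel (\<lambda>t. indicator {0<..} t * ((exp (- t) * f x - heat_semigroup t f x) / t))
    (c_const DIM('a) * ?I1 - c_const DIM('a) * ?I2 + rho_const DIM('a) * f x)"
  \<comment> \<open>The three known time integrals are added; the splitting identifies the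
    integrands for \<open>t > 0\<close>, and the indicator makes both vanish elsewhere.\<close>
  proof (rule has_bochner_integral_cong[THEN iffD1, OF refl _ refl])
    show "has_bochner_integral lborel (\<lambda>t. indicator {0<..} t * (?H t G1 / t) - indicator {0<..} t * (?H t G2 / t)
        + indicator {0<..} t * ((exp (- t) - ?H t (indicator (ball x 1))) / t) * f x)
      (c_const DIM('a) * ?I1 - c_const DIM('a) * ?I2 + rho_const DIM('a) * f x)"
      by (intro has_bochner_integral_add has_bochner_integral_diff H1 H2 H3)
    show "indicator {0<..} t * (?H t G1 / t) - indicator {0<..} t * (?H t G2 / t)
        + indicator {0<..} t * ((exp (- t) - ?H t (indicator (ball x 1))) / t) * f x =
      indicator {0<..} t * ((exp (- t) * f x - heat_semigroup t f x) / t)" for t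
    proof (cases "t > 0")
      case True
      show ?thesis unfolding split[OF True] using True
        by (simp only: add_divide_distrib diff_divide_distrib ring_distribs times_divide_eq_left times_divide_eq_right mult.assoc)
    qed simp
  qed
  moreover have "has_bochner_integral lborel (\<lambda>y. indicator (ball x 1) y * ((f x - f y) / norm (x - y) ^ DIM('a))) ?I1"
    "has_bochner_integral lborel (\<lambda>y. indicator (- ball x 1) y * (f y / norm (x - y) ^ DIM('a))) ?I2"
    using G1_int G2_int by (simp_all add: has_bochner_integral_iff G1_def G2_def)
  ultimately show ?thesis
    unfolding set_has_bochner_integral_iff by simp
qed

end
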